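(* Let $r\ne0$ be real, let $I=[I_{uv}]_{1\le u\le k,1\le v\le\ell}$ be a convex $0/1$ array, and let $0=\mathrm x_0<\dots<\mathrm x_k=1$, $0=\mathrm y_0<\dots<\mathrm y_\ell=1$. Let $\phi,\psi:[0,1]\to\mathbb R\cup\{\infty\}$ be continuous functions such that $$g(x,y)=-\frac1r\cdot\frac{\frac{\partial}{\partial x}\phi(x)\,\frac{\partial}{\partial y}\psi(y)}{[\phi(x)-\psi(y)]^2}$$ is non-negative for $(x,y)\in(\mathrm x_{u-1},\mathrm x_u)\times(\mathrm y_{v-1},\mathrm y_v)$ whenever $I_{uv}=1$ and satisfies $$\sum_{v=1}^\ell I_{uv}\int_{\mathrm y_{v-1}}^{\mathrm y_v}g(x,y)\,dy=1,\quad x\in(\mathrm x_{u-1},\mathrm x_u),\ 1\le u\le k;\qquad \sum_{u=1}^k I_{uv}\int_{\mathrm x_{u-1}}^{\mathrm x_u}g(x,y)\,dx=1,\quad y\in(\mathrm y_{v-1},\mathrm y_v),\ 1\le v\le\ell.$$ Then for each $u$ the restriction of $\phi$ to $[\mathrm x_{u-1},\mathrm x_u]$ is a Moebius transformation of $e^{rx}$, and for each $v$ the restriction of $\psi$ to $[\mathrm y_{v-1},\mathrm y_v]$ is a Moebius transformation of $e^{ry}$. Consequently, for each $(u,v)$ with $I_{uv}=1$ there are constants $a,b,c,d$ (depending on $u,v$) such that on $(\mathrm x_{u-1},\mathrm x_u)\times(\mathrm y_{v-1},\mathrm y_v)$ $$g(x,y)=-\frac{(ad-bc)\,r\,e^{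r(x+y)}}{\bigl(a+be^{ry}+ce^{rx}+de^{r(x+y)}\bigr)^2}.$$
   Context: Convex array: for each $u$ the set $\{v:I_{uv}=1\}$ is a non-empty segment of consecutive integers, and for each $v$ the set $\{u:I_{uv}=1\}$ is a non-empty segment of consecutive integers ($u$ indexes the horizontal and $v$ the vertical direction). $\mathbb R\cup\{\infty\}$ is the extended real line (real projective line). A Moebius transformation is $z\mapsto\frac{\alpha z+\beta}{\gamma z+\delta}$ with real $\alpha,\beta,\gamma,\delta$, $\alpha\delta-\beta\gamma\ne0$. It is understood that $\phi$ and $\psi$ take the value $\infty$ at finitely many points, that the restrictions of $\phi$ to each $[\mathrm x_{u-1},\mathrm x_u]$ and of $\psi$ to each $[\mathrm y_{v-1},\mathrm y_v]$ are continuously differentiable as maps to the projective line (one-sided derivatives at end-points), and that $\phi(x)\ne\psi(y)$ for $(x,y)\in[\mathrm x_{u-1},\mathrm x_u]\times[\mathrm y_{v-1},\mathrm y_v]$ whenever $I_{uv}=1$. At points where $\phi$ or $\psi$ is infinite the formula for $g$ is understood by continuity. *)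

theory Defs
  imports "HOL-Analysis.Analysis"
begin

text \<open>The real projective line: \<^term>\<open>None\<close> is the point at infinity, and the topology is
  that of the one-point compactification of the real line.\<close>

type_synonym rp1 = "real option"

abbreviation rp1_topology :: "rp1 topology" where
  "rp1_topology \<equiv> Alexandroff_compactification euclideanreal"

text \<open>The function \<^const>\<open>moebius\<close> of the library is only meaningful away from its pole; this is
  the total map of the projective line.\<close>

definition moebius_rp1 :: "real \<Rightarrow> real \<Rightarrow> real \<Rightarrow> real \<Rightarrow> rp1 \<Rightarrow> rp1" where
  "moebius_rp1 \<alpha> \<beta> \<gamma> \<delta> p =
     (case p of
        None \<Rightarrow> if \<gamma> = 0 then None else Some (\<alpha> / \<gamma>)
      | Some z \<Rightarrow> if \<gamma> * z + \<delta> = 0 then None else Some (moebius \<alpha> \<beta> \<gamma> \<delta> z))"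

definition is_moebius :: "(rp1 \<Rightarrow> rp1) \<Rightarrow> bool" where
  "is_moebius m \<longleftrightarrow> (\<exists>\<alpha> \<beta> \<gamma> \<delta>. \<alpha> * \<delta> - \<beta> * \<gamma> \<noteq> 0 \<and> m = moebius_rp1 \<alpha> \<beta> \<gamma> \<delta>)"

text \<open>Differentiability is relative to \<open>S\<close>, so it is one-sided at the end-points of a closed
  interval (hence not \<^const>\<open>C1_differentiable_on\<close>, which is two-sided).\<close>

definition C1_within :: "(real \<Rightarrow> real) \<Rightarrow> real set \<Rightarrow> bool" where
  "C1_within h S \<longleftrightarrow>
     (\<exists>h'. (\<forall>t\<in>S. (h has_real_derivative h' t) (at t within S)) \<and> continuous_on S h')"

text \<open>Inverse of the coordinate \<open>1/w\<close> around infinity; the other coordinate has inverse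
  \<^const>\<open>Some\<close>.\<close>

definition recip_rp1 :: "real \<Rightarrow> rp1" where
  "recip_rp1 z = (if z = 0 then None else Some (1 / z))"

definition C1_rp1_on :: "(real \<Rightarrow> rp1) \<Rightarrow> real set \<Rightarrow> bool" where
  "C1_rp1_on f S \<longleftrightarrow>
     (\<forall>t\<in>S. \<exists>\<epsilon>>0. \<exists>h. C1_within h (S \<inter> ball t \<epsilon>) \<and>
        ((\<forall>s\<in>S \<inter> ball t \<epsilon>. f s = Some (h s)) \<or> (\<forall>s\<in>S \<inter> ball t \<epsilon>. f s = recip_rp1 (h s))))"

definition convex_array :: "nat \<Rightarrow> nat \<Rightarrow> (nat \<Rightarrow> nat \<Rightarrow> nat) \<Rightarrow> bool" where
  "convex_array k l I \<longleftrightarrow>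
     (\<forall>u\<in>{1..k}. \<forall>v\<in>{1..l}. I u v \<in> {0, 1}) \<and>
     (\<forall>u\<in>{1..k}. \<exists>p q. p \<le> q \<and> {v\<in>{1..l}. I u v = 1} = {p..q}) \<and>
     (\<forall>v\<in>{1..l}. \<exists>p q. p \<le> q \<and> {u\<in>{1..k}. I u v = 1} = {p..q})"

definition finite_part :: "(real \<Rightarrow> rp1) \<Rightarrow> (real \<Rightarrow> rp1) \<Rightarrow> (real \<times> real) set" where
  "finite_part \<phi> \<psi> = {(x, y) \<in> {0..1} \<times> {0..1}. \<phi> x \<noteq> None \<and> \<psi> y \<noteq> None}"

definition g_formula :: "real \<Rightarrow> (real \<Rightarrow> rp1) \<Rightarrow> (real \<Rightarrow> rp1) \<Rightarrow> real \<Rightarrow> real \<Rightarrow> real" where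
  "g_formula r \<phi> \<psi> x y =
     - (1 / r) * (deriv (\<lambda>s. the (\<phi> s)) x * deriv (\<lambda>t. the (\<psi> t)) y) / (the (\<phi> x) - the (\<psi> y))\<^sup>2"

text \<open>Where \<open>\<phi>\<close> or \<open>\<psi>\<close> is infinite, the formula is extended by continuity. On grid lines
  \<open>x = x\<^sub>u\<close> or \<open>y = y\<^sub>v\<close> the value can be junk, but it is used there only as an end-point
  value of an integrand.\<close>

definition g_fun :: "real \<Rightarrow> (real \<Rightarrow> rp1) \<Rightarrow> (real \<Rightarrow> rp1) \<Rightarrow> real \<Rightarrow> real \<Rightarrow> real" where
  "g_fun r \<phi> \<psi> x y =
     (if (x, y) \<in> finite_part \<phi> \<psi> then g_formula r \<phi> \<psi> x y
      else Lim (at (x, y) within finite_part \<phi> \<psi>) (\<lambda>(s, t). g_formula r \<phi> \<psi> s t))"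

end

theory Submission
  imports Defs
begin

text \<open>Fix a horizontal interval and a point \<open>x\<close> in it with \<open>\<phi> x\<close> finite. The kernel is the
  \<open>y\<close>-derivative of \<open>- (1 / r) \<phi>'(x) / (\<phi>(x) - \<psi>(y))\<close>, and by convexity of the array the cells
  above \<open>x\<close> form one segment, from \<open>y\<^sub>m\<close> to \<open>y\<^sub>n\<close> say. So the sum of integrals telescopes, and the
  condition that it is \<open>1\<close> only sees the two numbers \<open>B = \<psi>(y\<^sub>m)\<close> and \<open>A = \<psi>(y\<^sub>n)\<close>:
  \<open>\<phi>' (1 / (\<phi> - A) - 1 / (\<phi> - B)) = - r\<close>.
  The left side is the logarithmic derivative of \<open>w = (\<phi> - A) / (\<phi> - B)\<close>, so \<open>w = C exp (- r x)\<close>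
  with \<open>C \<noteq> 0\<close>; also \<open>A \<noteq> B\<close>, since otherwise the left side would vanish. As \<open>w\<close> is a Moebius
  function of \<open>\<phi>\<close>, solving for \<open>\<phi>\<close> gives a Moebius function of \<open>exp (r x)\<close>. The situation is
  symmetric in \<open>\<phi>\<close> and \<open>\<psi>\<close>, and the formula for the kernel is a computation with the two Moebius
  matrices.

  The points at infinity are dealt with as follows. Values in the projective line are written in
  homogeneous coordinates, so that \<open>w\<close> and the antiderivative in \<open>y\<close> are both instances of one
  function \<open>coord a b\<close>, the projective coordinate with its zero at \<open>a\<close> and its pole at \<open>b\<close>, which is
  continuous away from \<open>b\<close> even at infinity (\<open>continuous_on_coord\<close>). At the finitely many parameters
  with infinite value this continuity suffices: the fundamental theorem of
  calculus for the Henstock--Kurzweil integral and the uniqueness theorem for \<open>w' = - r w\<close> both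
  allow finitely many points without derivative. The former gives the telescoped identity
  \<open>telescoped_integrals_eq\<close>, the latter \<open>moebius_of_telescoping_segment\<close>. Finally the kernel at the
  infinite points is the limit of its explicit formula (\<open>kernel_of_moebius\<close>).\<close>

section \<open>Homogeneous coordinates on the projective line\<close>

definition numer :: "rp1 \<Rightarrow> real" where
  "numer p = (case p of None \<Rightarrow> 1 | Some z \<Rightarrow> z)"

definition denom :: "rp1 \<Rightarrow> real" where
  "denom p = (case p of None \<Rightarrow> 0 | Some z \<Rightarrow> 1)"

text \<open>The determinant of two vectors of homogeneous coordinates; for finite points it is the
  difference \<open>p - q\<close>.\<close>

definition bracket :: "rp1 \<Rightarrow> rp1 \<Rightarrow> real" where
  "bracket p q = numer p * denom q - denom p * numer q"

text \<open>The projective coordinate with its zero at \<open>a\<close> and its pole at \<open>b\<close>. For finite points it is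
  \<open>(p - a) / (p - b)\<close>, and \<open>coord None (Some c) p\<close> is \<open>1 / (c - p)\<close>, with value \<open>0\<close> at infinity.\<close>

definition coord :: "rp1 \<Rightarrow> rp1 \<Rightarrow> rp1 \<Rightarrow> real" where
  "coord a b p = bracket p a / bracket p b"

lemma numer_denom_simps [simp]:
  "numer None = 1" "denom None = 0" "numer (Some z) = z" "denom (Some z) = 1"
  by (simp_all add: numer_def denom_def)

lemma bracket_eq_0_iff [simp]: "bracket p q = 0 \<longleftrightarrow> p = q"
  by (cases p; cases q) (auto simp: bracket_def)

text \<open>Continuity of \<^term>\<open>coord a b\<close> away from its pole, in terms of neighbourhoods. Those of
  infinity are the complements of compact sets, so there the claim is that the rational function has
  a limit as \<open>\<bar>z\<bar> \<rightarrow> \<infinity>\<close>.\<close>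

lemma coord_nhds:
  assumes "p \<noteq> b" "open W" "coord a b p \<in> W"
  obtains V where "openin rp1_topology V" "p \<in> V" "\<forall>s\<in>V. coord a b s \<in> W"
proof (cases p)
  case None
  then obtain \<beta> where b: "b = Some \<beta>" using assms(1) by (cases b) auto
  have lim: "((\<lambda>z. denom a + (denom a * \<beta> - numer a) / (z - \<beta>)) \<longlongrightarrow> denom a) at_infinity"
  proof -
    have "filterlim (\<lambda>z::real. - \<beta> + z) at_infinity at_infinity"
      by (intro tendsto_add_filterlim_at_infinity[OF tendsto_const] filterlim_ident)
    then have "((\<lambda>z. (denom a * \<beta> - numer a) / (- \<beta> + z)) \<longlongrightarrow> 0) at_infinity"
      by (intro tendsto_divide_0[OF tendsto_const])
    from tendsto_add[OF tendsto_const this] show ?thesis by simp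
  qed
  have "denom a \<in> W"
    using assms(3) None b by (simp add: coord_def bracket_def)
  then have "eventually (\<lambda>z. denom a + (denom a * \<beta> - numer a) / (z - \<beta>) \<in> W) at_infinity"
    using topological_tendstoD[OF lim assms(2)] by simp
  then obtain B0 where B0: "\<And>z. norm z \<ge> B0 \<Longrightarrow> denom a + (denom a * \<beta> - numer a) / (z - \<beta>) \<in> W"
    unfolding eventually_at_infinity by blast
  \<comment> \<open>Beyond \<open>\<bar>\<beta>\<bar>\<close>, so that the pole is excluded as well.\<close>
  define B where "B = max B0 (\<bar>\<beta>\<bar> + 1)"
  define V where "V = insert None (Some ` (topspace euclideanreal - cball 0 B))"
  have "coord a b (Some z) \<in> W" if "\<not> \<bar>z\<bar> \<le> B" for z
  proof -
    have "z \<noteq> \<beta>" using that by (auto simp: B_def)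
    then have "coord a b (Some z) = denom a + (denom a * \<beta> - numer a) / (z - \<beta>)"
      by (simp add: coord_def bracket_def b field_simps)
    then show ?thesis using B0[of z] that by (auto simp: B_def)
  qed
  then have "\<forall>s\<in>V. coord a b s \<in> W"
    using assms(3) None by (auto simp: V_def)
  moreover have "openin rp1_topology V"
    unfolding openin_Alexandroff_compactification V_def
    by (intro disjI2 exI[of _ "cball 0 B"]) (auto simp: compactin_euclidean_iff)
  ultimately show ?thesis using that[of V] None by (auto simp: V_def)
next
  case (Some z0)
  have ne: "z0 * denom b - numer b \<noteq> 0"
    using assms(1) bracket_eq_0_iff[of p b] by (simp add: Some bracket_def)
  have cont: "isCont (\<lambda>z. coord a b (Some z)) z0"
    unfolding coord_def bracket_def using ne by (auto intro!: continuous_intros)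
  then obtain U where U: "open U" "z0 \<in> U" "\<And>z. z \<in> U \<Longrightarrow> coord a b (Some z) \<in> W"
    using continuous_at_open[THEN iffD1, OF cont, rule_format, of W] assms(2,3) Some by auto
  show ?thesis
  proof (rule that[of "Some ` U"])
    show "openin rp1_topology (Some ` U)"
      using U(1) by (auto simp: openin_Alexandroff_compactification)
  qed (use U Some in auto)
qed

lemma continuous_on_coord:
  assumes "continuous_map (top_of_set T) rp1_topology f" "S \<subseteq> T" "\<And>t. t \<in> S \<Longrightarrow> f t \<noteq> b"
  shows "continuous_on S (\<lambda>t. coord a b (f t))"
  unfolding continuous_on_topological
proof (intro ballI allI impI)
  fix t W assume t: "t \<in> S" and W: "open W" "coord a b (f t) \<in> W"
  obtain V where V: "openin rp1_topology V" "f t \<in> V" "\<forall>s\<in>V. coord a b s \<in> W"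
    using coord_nhds[OF assms(3)[OF t] W] by blast
  have "openin (top_of_set T) {s \<in> T. f s \<in> V}"
    using openin_continuous_map_preimage[OF assms(1) V(1)] by simp
  then obtain A where "open A" "{s \<in> T. f s \<in> V} = T \<inter> A"
    by (auto simp: openin_open)
  then show "\<exists>A. open A \<and> t \<in> A \<and> (\<forall>s\<in>S. s \<in> A \<longrightarrow> coord a b (f s) \<in> W)"
    using t V assms(2) by (intro exI[of _ A]) blast
qed

lemma coord_has_real_derivative:
  assumes "open U" "t \<in> U" "\<And>s. s \<in> U \<Longrightarrow> f s \<noteq> None"
    and D: "((\<lambda>s. the (f s)) has_real_derivative D) (at t)" and "f t \<noteq> b"
  shows "((\<lambda>s. coord a b (f s)) has_real_derivative D * bracket a b / (bracket (f t) b)\<^sup>2) (at t)"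
proof -
  have fS: "f s = Some (the (f s))" if "s \<in> U" for s using assms(3)[OF that] by simp
  have ne: "the (f t) * denom b - numer b \<noteq> 0"
    using assms(5) bracket_eq_0_iff[of "f t" b] fS[OF assms(2)]
    by (metis bracket_def mult_1 numer_denom_simps(3,4))
  have br: "bracket (f s) q = the (f s) * denom q - numer q" if "s \<in> U" for s q
    by (subst fS[OF that]) (simp add: bracket_def)
  have "((\<lambda>s. (the (f s) * denom a - numer a) / (the (f s) * denom b - numer b))
      has_real_derivative D * bracket a b / (bracket (f t) b)\<^sup>2) (at t)"
    using ne unfolding br[OF assms(2)]
    by (auto intro!: derivative_eq_intros D simp: bracket_def power2_eq_square field_simps)
  then show ?thesis
    by (rule has_field_derivative_transform_within_open[OF _ assms(1,2)])
       (simp add: coord_def br)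
qed

text \<open>In either chart of the projective line, a differentiable map has a differentiable finite
  coordinate wherever its value is finite.\<close>

lemma C1_rp1_on_imp_differentiable:
  assumes "C1_rp1_on f S" "t \<in> interior S" "f t \<noteq> None"
  obtains D where "((\<lambda>s. the (f s)) has_real_derivative D) (at t)"
proof -
  have tS: "t \<in> S" using assms(2) interior_subset by blast
  obtain \<epsilon> h where e: "\<epsilon> > 0" and C: "C1_within h (S \<inter> ball t \<epsilon>)"
    and alt: "(\<forall>s\<in>S \<inter> ball t \<epsilon>. f s = Some (h s)) \<or> (\<forall>s\<in>S \<inter> ball t \<epsilon>. f s = recip_rp1 (h s))"
    using assms(1) tS unfolding C1_rp1_on_def by blast
  define U where "U = interior S \<inter> ball t \<epsilon>"
  have U: "open U" "t \<in> U" "U \<subseteq> S \<inter> ball t \<epsilon>"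
    using assms(2) e interior_subset by (auto simp: U_def)
  obtain h' where "(h has_real_derivative h') (at t within (S \<inter> ball t \<epsilon>))"
    using C tS e unfolding C1_within_def by force
  then have "(h has_real_derivative h') (at t within U)"
    using U(3) DERIV_subset by blast
  then have h': "(h has_real_derivative h') (at t)"
    using U at_within_open by metis
  from alt show ?thesis
  proof
    assume fh: "\<forall>s\<in>S \<inter> ball t \<epsilon>. f s = Some (h s)"
    have "h s = the (f s)" if "s \<in> U" for s
      using bspec[OF fh, of s] subsetD[OF U(3) that] by simp
    from has_field_derivative_transform_within_open[OF h' U(1,2) this] show ?thesis
      by (rule that)
  next
    assume rec: "\<forall>s\<in>S \<inter> ball t \<epsilon>. f s = recip_rp1 (h s)"
    have ht: "h t \<noteq> 0"
      using bspec[OF rec, of t] assms(3) tS e by (auto simp: recip_rp1_def)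
    \<comment> \<open>At zeros of \<open>h\<close> the value of \<open>f\<close> is infinite and \<open>the (f s)\<close> is unspecified, so these are
      kept away.\<close>
    obtain A where A: "open A" "t \<in> A" "\<And>s. s \<in> A \<Longrightarrow> h s \<noteq> 0"
      using DERIV_isCont[OF h'] ht open_delete[OF open_UNIV, of 0]
        continuous_at_open[THEN iffD1, of t h, rule_format, of "UNIV - {0}"] by auto
    have "((\<lambda>s. 1 / h s) has_real_derivative - h' / (h t)\<^sup>2) (at t)"
      using ht by (auto intro!: derivative_eq_intros h' simp: power2_eq_square)
    then have "((\<lambda>s. the (f s)) has_real_derivative - h' / (h t)\<^sup>2) (at t)"
    proof (rule has_field_derivative_transform_within_open[of _ _ _ "A \<inter> U"])
      fix s assume s: "s \<in> A \<inter> U"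
      then have "s \<in> S \<inter> ball t \<epsilon>" using U(3) by blast
      then show "1 / h s = the (f s)"
        using bspec[OF rec] A(3)[of s] s by (simp add: recip_rp1_def)
    qed (use A U in auto)
    then show ?thesis by (rule that)
  qed
qed


section \<open>From the integral condition to an exponential\<close>

text \<open>With \<open>c\<close> for the value and \<open>D\<close> for the derivative of the function of \<open>x\<close> at a fixed point, the
  kernel \<open>K\<close> has the antiderivative \<open>- (D / r) / (c - h y)\<close>, which extends continuously by \<open>0\<close> to the
  points with \<open>h y\<close> infinite; being finitely many, these do not contribute to the integral.\<close>

lemma telescoped_integrals_eq:
  assumes r: "r \<noteq> 0" and h: "continuous_map (top_of_set {0..1}) rp1_topology h"
    and fin: "finite {y \<in> {0..1}. h y = None}"
    and "m \<le> n" and t: "\<And>v. v \<in> {Suc m..n} \<Longrightarrow> t (v - 1) < t v"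
    and sub: "\<And>v. v \<in> {Suc m..n} \<Longrightarrow> {t (v - 1)..t v} \<subseteq> {0..1}"
    and C1: "\<And>v. v \<in> {Suc m..n} \<Longrightarrow> C1_rp1_on h {t (v - 1)..t v}"
    and ne: "\<And>v y. v \<in> {Suc m..n} \<Longrightarrow> y \<in> {t (v - 1)..t v} \<Longrightarrow> h y \<noteq> Some c"
    and K: "\<And>y. y \<in> {0..1} \<Longrightarrow> h y \<noteq> None \<Longrightarrow>
              K y = - (1 / r) * (D * deriv (\<lambda>s. the (h s)) y) / (c - the (h y))\<^sup>2"
    and sum: "(\<Sum>v=Suc m..n. integral {t (v - 1)..t v} K) = 1"
  shows "D * (coord None (Some c) (h (t n)) - coord None (Some c) (h (t m))) = - r"
proof -
  define F where "F = (\<lambda>y. coord None (Some c) (h y))"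
  have int: "integral {t (v - 1)..t v} K = - (D / r) * F (t v) - - (D / r) * F (t (v - 1))"
    if v: "v \<in> {Suc m..n}" for v
  proof -
    let ?S = "{y \<in> {0..1}. h y = None}"
    have "(K has_integral - (D / r) * F (t v) - - (D / r) * F (t (v - 1))) {t (v - 1)..t v}"
    proof (rule fundamental_theorem_of_calculus_interior_strong[OF fin])
      show "t (v - 1) \<le> t v" using t[OF v] by simp
      show "continuous_on {t (v - 1)..t v} (\<lambda>y. - (D / r) * F y)"
        unfolding F_def by (intro continuous_intros continuous_on_coord[OF h sub[OF v]] ne[OF v])
      fix y assume y: "y \<in> {t (v - 1)<..<t v} - ?S"
      let ?U = "{t (v - 1)<..<t v} - ?S"
      have yh: "h y \<noteq> None" and y01: "y \<in> {0..1}" using y sub[OF v] by auto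
      obtain E where E: "((\<lambda>s. the (h s)) has_real_derivative E) (at y)"
        using C1_rp1_on_imp_differentiable[OF C1[OF v] _ yh] y by auto
      have hy: "h y = Some (the (h y))" using yh by simp
      have nc: "h y \<noteq> Some c" using ne[OF v] y by auto
      have "(F has_real_derivative E * bracket None (Some c) / (bracket (h y) (Some c))\<^sup>2) (at y)"
        unfolding F_def
      proof (rule coord_has_real_derivative[OF _ y _ E nc])
        show "open ?U" using fin by (intro open_Diff finite_imp_closed) auto
        show "h s \<noteq> None" if "s \<in> ?U" for s using that sub[OF v] by auto
      qed
      moreover have "E * bracket None (Some c) / (bracket (h y) (Some c))\<^sup>2 = E / (c - the (h y))\<^sup>2"
        by (subst hy) (simp add: bracket_def power2_commute)
      ultimately have "((\<lambda>y. - (D / r) * F y) has_real_derivative - (D / r) * (E / (c - the (h y))\<^sup>2)) (at y)"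
        by (intro DERIV_cmult) simp
      moreover have "K y = - (D / r) * (E / (c - the (h y))\<^sup>2)"
        using K[OF y01 yh] DERIV_imp_deriv[OF E] by simp
      ultimately show "((\<lambda>y. - (D / r) * F y) has_vector_derivative K y) (at y)"
        by (simp add: has_real_derivative_iff_has_vector_derivative)
    qed
    then show ?thesis by (rule integral_unique)
  qed
  have "1 = (\<Sum>v=Suc m..n. - (D / r) * F (t v) - - (D / r) * F (t (v - 1)))"
    unfolding sum[symmetric] by (rule sum.cong[OF refl int])
  also have "\<dots> = - (D / r) * F (t n) - - (D / r) * F (t m)"
    by (rule sum_telescope''[OF \<open>m \<le> n\<close>])
  finally show ?thesis using r by (simp add: F_def field_simps)
qed

text \<open>The differential equation makes \<open>w x * exp (r * x)\<close> locally constant off the finite exceptional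
  set, and continuity bridges the exceptions.\<close>

lemma exponential_if_derivative:
  fixes w :: "real \<Rightarrow> real"
  assumes cont: "continuous_on {a..b} w" and fin: "finite S"
    and D: "\<And>x. x \<in> {a<..<b} - S \<Longrightarrow> (w has_real_derivative - r * w x) (at x)"
    and x: "x \<in> {a..b}"
  shows "w x * exp (r * x) = w a * exp (r * a)"
proof (rule has_derivative_zero_unique_strong_interval[where k = "S \<union> {a, b}" and a = a and b = b
      and f = "\<lambda>x. w x * exp (r * x)" and x = x])
  show "continuous_on {a..b} (\<lambda>x. w x * exp (r * x))"
    by (intro continuous_intros cont)
  fix x assume "x \<in> {a..b} - (S \<union> {a, b})"
  then have "x \<in> {a<..<b} - S" by auto
  note Dx = D[OF this]
  have Dexp: "((\<lambda>x. exp (r * x)) has_real_derivative r * exp (r * x)) (at x)"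
    by (auto intro!: derivative_eq_intros)
  have "((\<lambda>x. w x * exp (r * x)) has_real_derivative 0) (at x)"
    using DERIV_mult[OF Dx Dexp] by simp
  then have "((\<lambda>x. w x * exp (r * x)) has_derivative (*) 0) (at x within {a..b})"
    unfolding has_field_derivative_def by (rule has_derivative_at_withinI)
  moreover have "(*) (0::real) = (\<lambda>h. 0)" by auto
  ultimately show "((\<lambda>x. w x * exp (r * x)) has_derivative (\<lambda>h. 0)) (at x within {a..b})"
    by simp
qed (use fin x in auto)

text \<open>Solving \<open>coord a b p = C / z\<close> for \<open>p\<close>: in homogeneous coordinates the equation is
  \<open>bracket p a * z = C * bracket p b\<close>, linear in \<open>p\<close>, and its solution has the Moebius matrix below
  with determinant \<open>- C * bracket a b\<close>.\<close>

lemma moebius_of_coord: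
  assumes "p \<noteq> b" "a \<noteq> b" "C \<noteq> 0" "coord a b p * z = C"
  shows "p = moebius_rp1 (numer a) (- C * numer b) (denom a) (- C * denom b) (Some z)"
    and "numer a * (- C * denom b) - (- C * numer b) * denom a \<noteq> 0"
proof -
  have ab: "bracket a b \<noteq> 0" using assms(2) by simp
  have "numer a * (- C * denom b) - (- C * numer b) * denom a = - C * bracket a b"
    by (simp add: bracket_def algebra_simps)
  then show det: "numer a * (- C * denom b) - (- C * numer b) * denom a \<noteq> 0"
    using ab assms(3) by simp
  have eq: "bracket p a * z = C * bracket p b"
    using assms(1,4) bracket_eq_0_iff[of p b] by (simp add: coord_def field_simps)
  show "p = moebius_rp1 (numer a) (- C * numer b) (denom a) (- C * denom b) (Some z)"
  proof (cases p)
    case None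
    then show ?thesis using eq by (simp add: moebius_rp1_def bracket_def)
  next
    case (Some s)
    then have s: "s * (denom a * z + - C * denom b) = numer a * z + - C * numer b"
      using eq by (simp add: bracket_def algebra_simps)
    have "denom a * z + - C * denom b \<noteq> 0"
    proof
      assume 0: "denom a * z + - C * denom b = 0"
      then have "numer a * z + - C * numer b = 0" using s by simp
      with 0 have *: "C * numer b = numer a * z" "C * denom b = denom a * z" by simp_all
      have "C * bracket a b = numer a * (C * denom b) - denom a * (C * numer b)"
        by (simp add: bracket_def algebra_simps)
      also have "\<dots> = 0" unfolding * by simp
      finally have "C * bracket a b = 0" .
      then show False using ab assms(3) by simp
    qed
    then show ?thesis using Some s by (simp add: moebius_rp1_def moebius_def nonzero_eq_divide_eq)
  qed
qed

text \<open>The kernel is an arbitrary \<open>K\<close>, prescribed only where both functions are finite, so that the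
  lemma serves for integration in either variable.\<close>

lemma moebius_of_telescoping_segment:
  assumes r: "r \<noteq> 0" and ab: "a < b" "{a..b} \<subseteq> {0..1}"
    and f: "continuous_map (top_of_set {0..1}) rp1_topology f"
    and h: "continuous_map (top_of_set {0..1}) rp1_topology h"
    and finf: "finite {x \<in> {0..1}. f x = None}" and finh: "finite {y \<in> {0..1}. h y = None}"
    and C1f: "C1_rp1_on f {a..b}"
    and mn: "m < n" and t: "\<And>v. v \<in> {Suc m..n} \<Longrightarrow> t (v - 1) < t v"
    and sub: "\<And>v. v \<in> {Suc m..n} \<Longrightarrow> {t (v - 1)..t v} \<subseteq> {0..1}"
    and C1h: "\<And>v. v \<in> {Suc m..n} \<Longrightarrow> C1_rp1_on h {t (v - 1)..t v}"
    and ne: "\<And>v x y. v \<in> {Suc m..n} \<Longrightarrow> x \<in> {a..b} \<Longrightarrow> y \<in> {t (v - 1)..t v} \<Longrightarrow> f x \<noteq> h y"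
    and K: "\<And>x y. x \<in> {0..1} \<Longrightarrow> y \<in> {0..1} \<Longrightarrow> f x \<noteq> None \<Longrightarrow> h y \<noteq> None \<Longrightarrow>
              K x y = g_formula r f h x y"
    and sum: "\<And>x. x \<in> {a<..<b} \<Longrightarrow> (\<Sum>v=Suc m..n. integral {t (v - 1)..t v} (K x)) = 1"
  shows "\<exists>M. is_moebius M \<and> (\<forall>x\<in>{a..b}. f x = M (Some (exp (r * x))))"
proof -
  define A where "A = h (t n)"
  define B where "B = h (t m)"
  have fA: "f x \<noteq> A" and fB: "f x \<noteq> B" if "x \<in> {a..b}" for x
    using ne[of n x "t n"] ne[of "Suc m" x "t m"] t[of n] t[of "Suc m"] mn that
    by (auto simp: A_def B_def)
  define w where "w = (\<lambda>x. coord A B (f x))"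
  let ?S = "{x \<in> {0..1}. f x = None}"
  let ?U = "{a<..<b} - ?S"
  have U: "open ?U" using finf by (intro open_Diff finite_imp_closed) auto
  have Ufin: "f x \<noteq> None" if "x \<in> ?U" for x using that ab(2) by auto
  have key: "deriv (\<lambda>s. the (f s)) x * (bracket A B / (bracket (f x) A * bracket (f x) B)) = - r"
    if x: "x \<in> ?U" for x
  proof -
    have x01: "x \<in> {0..1}" and xab: "x \<in> {a..b}" using x ab(2) by auto
    have fx: "f x = Some (the (f x))" using Ufin[OF x] by simp
    have "deriv (\<lambda>s. the (f s)) x *
        (coord None (Some (the (f x))) (h (t n)) - coord None (Some (the (f x))) (h (t m))) = - r"
    proof (rule telescoped_integrals_eq[where t = t, OF r h finh less_imp_le[OF mn] t sub C1h])
      show "h y \<noteq> Some (the (f x))" if "v \<in> {Suc m..n}" "y \<in> {t (v - 1)..t v}" for v y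
        using ne[OF that(1) xab that(2)] fx by simp
      show "K x y = - (1 / r) * (deriv (\<lambda>s. the (f s)) x * deriv (\<lambda>s. the (h s)) y) /
            (the (f x) - the (h y))\<^sup>2" if "y \<in> {0..1}" "h y \<noteq> None" for y
        using K[OF x01 that(1) Ufin[OF x] that(2)] by (simp add: g_formula_def)
      show "(\<Sum>v=Suc m..n. integral {t (v - 1)..t v} (K x)) = 1"
        using sum x by blast
    qed auto
    moreover have "coord None (Some (the (f x))) (h (t n)) - coord None (Some (the (f x))) (h (t m))
        = bracket A B / (bracket (f x) A * bracket (f x) B)"
    proof -
      define z where "z = the (f x)"
      have br: "bracket (f x) q = z * denom q - numer q" for q
        by (subst fx) (simp add: bracket_def z_def)
      have co: "coord None (Some z) q = denom q / (z * denom q - numer q)" for q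
        using minus_divide_divide[of "denom q" "z * denom q - numer q"]
        by (simp add: coord_def bracket_def mult.commute)
      have nz: "z * denom A - numer A \<noteq> 0" "z * denom B - numer B \<noteq> 0"
        using fA[OF xab] fB[OF xab] br[of A] br[of B] bracket_eq_0_iff by metis+
      have "coord None (Some z) A - coord None (Some z) B =
          (denom A * (z * denom B - numer B) - denom B * (z * denom A - numer A)) /
          ((z * denom A - numer A) * (z * denom B - numer B))"
        unfolding co using nz by (simp add: diff_frac_eq)
      then show ?thesis
        unfolding br A_def[symmetric] B_def[symmetric] z_def[symmetric]
        by (simp add: bracket_def algebra_simps)
    qed
    ultimately show ?thesis by simp
  qed
  \<comment> \<open>The identity just proved says that the logarithmic derivative of \<open>w\<close> is \<open>- r\<close>.\<close>
  have wE: "w x * exp (r * x) = w a * exp (r * a)" if "x \<in> {a..b}" for x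
  proof (rule exponential_if_derivative[OF _ finf _ that])
    show "continuous_on {a..b} w"
      unfolding w_def by (rule continuous_on_coord[OF f ab(2) fB])
    fix x assume x: "x \<in> ?U"
    have xab: "x \<in> {a..b}" using x by auto
    obtain D where D: "((\<lambda>s. the (f s)) has_real_derivative D) (at x)"
      using C1_rp1_on_imp_differentiable[OF C1f _ Ufin[OF x]] x by auto
    have "(w has_real_derivative D * bracket A B / (bracket (f x) B)\<^sup>2) (at x)"
      unfolding w_def by (rule coord_has_real_derivative[OF U x Ufin D fB[OF xab]])
    moreover have "D * bracket A B / (bracket (f x) B)\<^sup>2 = - r * w x"
      unfolding key[OF x, symmetric] DERIV_imp_deriv[OF D] w_def coord_def
      using fA[OF xab] fB[OF xab] by (simp add: field_simps power2_eq_square)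
    ultimately show "(w has_real_derivative - r * w x) (at x)" by simp
  qed
  have AB: "A \<noteq> B"
  proof
    assume "A = B"
    have "infinite ?U" using ab(1) finf by (simp add: infinite_Ioo)
    then obtain x where "x \<in> ?U" by (metis ex_in_conv finite.emptyI)
    have z: "bracket B B = 0" by simp
    have "- r = 0" using key[OF \<open>x \<in> ?U\<close>] unfolding \<open>A = B\<close> z by simp
    then show False using r by simp
  qed
  define C where "C = w a * exp (r * a)"
  have C: "C \<noteq> 0"
    using fA[of a] fB[of a] ab(1) by (simp add: C_def w_def coord_def)
  have wC: "coord A B (f x) * exp (r * x) = C" if "x \<in> {a..b}" for x
    using wE[OF that] unfolding C_def w_def .
  have a: "a \<in> {a..b}" using ab(1) by simp
  have "\<forall>x\<in>{a..b}. f x =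
      moebius_rp1 (numer A) (- C * numer B) (denom A) (- C * denom B) (Some (exp (r * x)))"
    using moebius_of_coord(1)[OF fB AB C wC] by blast
  moreover have "is_moebius (moebius_rp1 (numer A) (- C * numer B) (denom A) (- C * denom B))"
    unfolding is_moebius_def using moebius_of_coord(2)[OF fB[OF a] AB C wC[OF a]] by blast
  ultimately show ?thesis by blast
qed

section \<open>The kernel of two Moebius functions of exponentials\<close>

text \<open>On homogeneous coordinates a Moebius transformation is its matrix, up to a nonzero scalar;
  this treats finite and infinite values alike.\<close>

lemma moebius_rp1_homogeneous:
  assumes "\<alpha> * \<delta> - \<beta> * \<gamma> \<noteq> 0"
  obtains \<kappa> where "\<kappa> \<noteq> 0"
    and "\<alpha> * z + \<beta> = \<kappa> * numer (moebius_rp1 \<alpha> \<beta> \<gamma> \<delta> (Some z))"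
    and "\<gamma> * z + \<delta> = \<kappa> * denom (moebius_rp1 \<alpha> \<beta> \<gamma> \<delta> (Some z))"
proof (cases "\<gamma> * z + \<delta> = 0")
  case True
  have "\<alpha> * z + \<beta> \<noteq> 0"
  proof
    assume 0: "\<alpha> * z + \<beta> = 0"
    have "\<alpha> * \<delta> - \<beta> * \<gamma> = \<alpha> * (\<gamma> * z + \<delta>) - \<gamma> * (\<alpha> * z + \<beta>)" by (simp add: algebra_simps)
    then show False using assms unfolding True 0 by simp
  qed
  with True show ?thesis by (intro that[of "\<alpha> * z + \<beta>"]) (auto simp: moebius_rp1_def)
next
  case False
  then show ?thesis
    by (intro that[of "\<gamma> * z + \<delta>"]) (auto simp: moebius_rp1_def moebius_def)
qed

lemma deriv_moebius_exp:
  assumes S: "finite S" and x: "x \<in> {a<..<b} - S"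
    and f: "\<And>s. s \<in> {a<..<b} \<Longrightarrow> f s = moebius_rp1 \<alpha> \<beta> \<gamma> \<delta> (Some (exp (r * s)))"
    and fin: "\<And>s. s \<in> {a<..<b} - S \<Longrightarrow> f s \<noteq> None"
  shows "deriv (\<lambda>s. the (f s)) x =
           (\<alpha> * \<delta> - \<beta> * \<gamma>) * r * exp (r * x) / (\<gamma> * exp (r * x) + \<delta>)\<^sup>2"
proof (rule DERIV_imp_deriv)
  have ne: "\<gamma> * exp (r * s) + \<delta> \<noteq> 0" if "s \<in> {a<..<b} - S" for s
    using fin[OF that] f[of s] that by (auto simp: moebius_rp1_def split: if_splits)
  have "((\<lambda>s. (\<alpha> * exp (r * s) + \<beta>) / (\<gamma> * exp (r * s) + \<delta>)) has_real_derivative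
      (\<alpha> * \<delta> - \<beta> * \<gamma>) * r * exp (r * x) / (\<gamma> * exp (r * x) + \<delta>)\<^sup>2) (at x)"
    using ne[OF x]
    by (auto intro!: derivative_eq_intros simp: power2_eq_square algebra_simps)
  then show "((\<lambda>s. the (f s)) has_real_derivative
      (\<alpha> * \<delta> - \<beta> * \<gamma>) * r * exp (r * x) / (\<gamma> * exp (r * x) + \<delta>)\<^sup>2) (at x)"
  proof (rule has_field_derivative_transform_within_open[OF _ _ x])
    show "open ({a<..<b} - S)" using S by (intro open_Diff finite_imp_closed) auto
    show "(\<alpha> * exp (r * s) + \<beta>) / (\<gamma> * exp (r * s) + \<delta>) = the (f s)"
      if "s \<in> {a<..<b} - S" for s
      using f[of s] ne[OF that] that by (simp add: moebius_rp1_def moebius_def)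
  qed
qed

text \<open>Makes the limit that defines the kernel at infinite points unique.\<close>

lemma islimpt_Times_minus_finite:
  fixes x y :: real
  assumes "x \<in> {a<..<b}" "y \<in> {c<..<d}" "finite S" "finite T"
  shows "(x, y) islimpt ({a<..<b} - S) \<times> ({c<..<d} - T)"
  unfolding islimpt_approachable
proof (intro allI impI)
  fix e :: real assume e: "e > 0"
  have *: "\<exists>s\<in>{a'<..<b'} - X. s \<noteq> z \<and> dist s z < e / 2"
    if "z \<in> {a'<..<b'}" "finite X" for z a' b' :: real and X
  proof -
    have "infinite ({max a' (z - e / 2)<..<z} - X)"
      using that e by (simp add: infinite_Ioo)
    then obtain s where "s \<in> {max a' (z - e / 2)<..<z} - X"
      by (metis ex_in_conv finite.emptyI)
    then show ?thesis using that e by (intro bexI[of _ s]) (auto simp: dist_real_def)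
  qed
  obtain s t where s: "s \<in> {a<..<b} - S" "s \<noteq> x" "dist s x < e / 2"
    and t: "t \<in> {c<..<d} - T" "dist t y < e / 2"
    using *[OF assms(1,3)] *[OF assms(2,4)] by blast
  have "dist (s, t) (x, y) \<le> dist s x + dist t y"
    unfolding dist_Pair_Pair by (rule sqrt_sum_squares_le_sum) auto
  then have "dist (s, t) (x, y) < e" using s t by linarith
  then show "\<exists>p\<in>({a<..<b} - S) \<times> ({c<..<d} - T). p \<noteq> (x, y) \<and> dist p (x, y) < e"
    using s t by (intro bexI[of _ "(s, t)"]) auto
qed

text \<open>Let \<open>M\<close>, \<open>M'\<close> be the two matrices and \<open>E = exp (r x)\<close>, \<open>F = exp (r y)\<close>. Up to the scalars of
  homogeneous coordinates, \<open>f x - h y\<close> is the bracket \<open>N\<close> of \<open>M (E, 1)\<close> and \<open>M' (F, 1)\<close>. This is a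
  bilinear form in \<open>(E, 1)\<close> and \<open>(F, 1)\<close> with matrix \<open>M\<^sup>T J M'\<close>, where \<open>J\<close> is the rotation by a right
  angle; hence its determinant is \<open>A D - B C = det M det M'\<close>, which is the numerator that the two
  derivatives produce. The resulting expression is continuous on the whole cell, so it is also the
  limit at the infinite points.\<close>

lemma kernel_of_moebius:
  assumes r: "r \<noteq> 0" and sub: "{a<..<b} \<subseteq> {0..1}" "{c<..<d} \<subseteq> {0..1}"
    and finf: "finite {x \<in> {0..1}. f x = None}" and finh: "finite {y \<in> {0..1}. h y = None}"
    and f: "\<And>x. x \<in> {a<..<b} \<Longrightarrow> f x = moebius_rp1 \<alpha> \<beta> \<gamma> \<delta> (Some (exp (r * x)))"
    and h: "\<And>y. y \<in> {c<..<d} \<Longrightarrow> h y = moebius_rp1 \<alpha>' \<beta>' \<gamma>' \<delta>' (Some (exp (r * y)))"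
    and det: "\<alpha> * \<delta> - \<beta> * \<gamma> \<noteq> 0" "\<alpha>' * \<delta>' - \<beta>' * \<gamma>' \<noteq> 0"
    and ne: "\<And>x y. x \<in> {a<..<b} \<Longrightarrow> y \<in> {c<..<d} \<Longrightarrow> f x \<noteq> h y"
  shows "\<exists>A B C D. \<forall>x\<in>{a<..<b}. \<forall>y\<in>{c<..<d}.
           A + B * exp (r * y) + C * exp (r * x) + D * exp (r * (x + y)) \<noteq> 0 \<and>
           g_fun r f h x y = - ((A * D - B * C) * r * exp (r * (x + y)) /
             (A + B * exp (r * y) + C * exp (r * x) + D * exp (r * (x + y)))\<^sup>2)"
proof -
  define A B C D where "A = \<beta> * \<delta>' - \<beta>' * \<delta>" and "B = \<beta> * \<gamma>' - \<alpha>' * \<delta>"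
    and "C = \<alpha> * \<delta>' - \<beta>' * \<gamma>" and "D = \<alpha> * \<gamma>' - \<alpha>' * \<gamma>"
  define N where "N = (\<lambda>x y. A + B * exp (r * y) + C * exp (r * x) + D * exp (r * (x + y)))"
  define G where "G = (\<lambda>x y. - ((A * D - B * C) * r * exp (r * (x + y)) / (N x y)\<^sup>2))"
  have detN: "A * D - B * C = (\<alpha> * \<delta> - \<beta> * \<gamma>) * (\<alpha>' * \<delta>' - \<beta>' * \<gamma>')"
    by (simp add: A_def B_def C_def D_def algebra_simps)
  have N_eq: "N x y = (\<alpha> * exp (r * x) + \<beta>) * (\<gamma>' * exp (r * y) + \<delta>')
      - (\<gamma> * exp (r * x) + \<delta>) * (\<alpha>' * exp (r * y) + \<beta>')" for x y
    by (simp add: N_def A_def B_def C_def D_def exp_add algebra_simps)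
  have N0: "N x y \<noteq> 0" if xy: "x \<in> {a<..<b}" "y \<in> {c<..<d}" for x y
  proof -
    obtain \<kappa> where k: "\<kappa> \<noteq> 0" "\<alpha> * exp (r * x) + \<beta> = \<kappa> * numer (f x)"
        "\<gamma> * exp (r * x) + \<delta> = \<kappa> * denom (f x)"
      using moebius_rp1_homogeneous[OF det(1), of "exp (r * x)"] f[OF xy(1)] by metis
    obtain \<kappa>' where k': "\<kappa>' \<noteq> 0" "\<alpha>' * exp (r * y) + \<beta>' = \<kappa>' * numer (h y)"
        "\<gamma>' * exp (r * y) + \<delta>' = \<kappa>' * denom (h y)"
      using moebius_rp1_homogeneous[OF det(2), of "exp (r * y)"] h[OF xy(2)] by metis
    have "N x y = \<kappa> * \<kappa>' * bracket (f x) (h y)"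
      unfolding N_eq k k' by (simp add: bracket_def algebra_simps)
    then show ?thesis using k(1) k'(1) ne[OF xy] by simp
  qed
  let ?S = "{x \<in> {0..1}. f x = None}" and ?T = "{y \<in> {0..1}. h y = None}"
  let ?P = "({a<..<b} - ?S) \<times> ({c<..<d} - ?T)"
  have P: "?P \<subseteq> finite_part f h" using sub by (auto simp: finite_part_def)
  have on_P: "g_formula r f h x y = G x y" if "(x, y) \<in> ?P" for x y
  proof -
    have x: "x \<in> {a<..<b} - ?S" and y: "y \<in> {c<..<d} - ?T" using that by auto
    have fx: "f x \<noteq> None" and hy: "h y \<noteq> None" using x y sub by auto
    define E F where "E = exp (r * x)" and "F = exp (r * y)"
    have nz: "\<gamma> * E + \<delta> \<noteq> 0" "\<gamma>' * F + \<delta>' \<noteq> 0"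
      using fx hy f[of x] h[of y] x y
      by (auto simp: moebius_rp1_def E_def F_def split: if_splits)
    have df: "deriv (\<lambda>s. the (f s)) x = (\<alpha> * \<delta> - \<beta> * \<gamma>) * r * E / (\<gamma> * E + \<delta>)\<^sup>2"
      unfolding E_def by (rule deriv_moebius_exp[OF finf x f]) (use sub in auto)
    have dh: "deriv (\<lambda>s. the (h s)) y = (\<alpha>' * \<delta>' - \<beta>' * \<gamma>') * r * F / (\<gamma>' * F + \<delta>')\<^sup>2"
      unfolding F_def by (rule deriv_moebius_exp[OF finh y h]) (use sub in auto)
    have "the (f x) = (\<alpha> * E + \<beta>) / (\<gamma> * E + \<delta>)" "the (h y) = (\<alpha>' * F + \<beta>') / (\<gamma>' * F + \<delta>')"
      using f[of x] h[of y] x y nz by (simp_all add: moebius_rp1_def moebius_def E_def F_def)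
    then have diff: "the (f x) - the (h y) = N x y / ((\<gamma> * E + \<delta>) * (\<gamma>' * F + \<delta>'))"
      using nz unfolding N_eq E_def[symmetric] F_def[symmetric]
      by (simp add: diff_frac_eq mult.commute)
    have "N x y \<noteq> 0" using N0 x y by auto
    then have "g_formula r f h x y =
        - ((\<alpha> * \<delta> - \<beta> * \<gamma>) * (\<alpha>' * \<delta>' - \<beta>' * \<gamma>') * r * (E * F) / (N x y)\<^sup>2)"
      unfolding g_formula_def df dh diff using nz r
      by (simp add: power_divide power_mult_distrib power2_eq_square)
    then show ?thesis
      by (simp add: G_def detN E_def F_def exp_add distrib_left)
  qed
  have "g_fun r f h x y = G x y" if xy: "x \<in> {a<..<b}" "y \<in> {c<..<d}" for x y
  proof (cases "(x, y) \<in> finite_part f h")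
    case True
    then show ?thesis using on_P[of x y] xy by (auto simp: g_fun_def finite_part_def)
  next
    case False
    let ?F = "at (x, y) within finite_part f h"
    have "isCont (\<lambda>p. G (fst p) (snd p)) (x, y)"
      unfolding G_def using N0[OF xy] unfolding N_def by (auto intro!: continuous_intros)
    then have "((\<lambda>p. G (fst p) (snd p)) \<longlongrightarrow> G x y) ?F"
      using tendsto_within_subset[of _ _ "(x, y)" UNIV] by (fastforce simp: isCont_def)
    moreover have "eventually (\<lambda>p. G (fst p) (snd p) = (case p of (s, t) \<Rightarrow> g_formula r f h s t)) ?F"
      unfolding eventually_at_topological
    proof (intro exI[of _ "{a<..<b} \<times> {c<..<d}"] conjI ballI impI)
      show "open ({a<..<b} \<times> {c<..<d})" by (intro open_Times) auto
      fix p assume "p \<in> {a<..<b} \<times> {c<..<d}" "p \<in> finite_part f h"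
      then show "G (fst p) (snd p) = (case p of (s, t) \<Rightarrow> g_formula r f h s t)"
        using on_P[of "fst p" "snd p"] by (auto simp: finite_part_def)
    qed (use xy in auto)
    ultimately have "((\<lambda>(s, t). g_formula r f h s t) \<longlongrightarrow> G x y) ?F"
      by (rule Lim_transform_eventually)
    moreover have "\<not> trivial_limit ?F"
      using islimpt_subset[OF islimpt_Times_minus_finite[OF xy finf finh] P]
      by (simp add: trivial_limit_within)
    ultimately have "Lim ?F (\<lambda>(s, t). g_formula r f h s t) = G x y"
      by (intro tendsto_Lim)
    then show ?thesis using False by (simp add: g_fun_def)
  qed
  then show ?thesis using N0 unfolding G_def N_def by blast
qed

section \<open>The convex array\<close>

lemma sum_segment:
  fixes J :: "nat \<Rightarrow> real"
  assumes "\<forall>v\<in>{1..l}. I v \<in> {0, 1::nat}" "{v \<in> {1..l}. I v = 1} = {p..q}"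
  shows "(\<Sum>v=1..l. real (I v) * J v) = (\<Sum>v=p..q. J v)"
proof -
  have "(\<Sum>v=1..l. real (I v) * J v) = (\<Sum>v\<in>{1..l}. if I v = 1 then J v else 0)"
    using assms(1) by (intro sum.cong) auto
  also have "\<dots> = (\<Sum>v\<in>{v \<in> {1..l}. I v = 1}. J v)"
    by (rule sum.inter_filter[symmetric]) simp
  finally show ?thesis unfolding assms(2) .
qed

lemma grid_cell:
  fixes xs :: "nat \<Rightarrow> real"
  assumes "xs 0 = 0" "xs k = 1" "strict_mono_on {0..k} xs" "u \<in> {1..k}"
  shows "xs (u - 1) < xs u" "{xs (u - 1)..xs u} \<subseteq> {0..1}"
proof -
  show "xs (u - 1) < xs u"
    using strict_mono_onD[OF assms(3), of "u - 1" u] assms(4) by auto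
  have "xs 0 \<le> xs (u - 1)" "xs u \<le> xs k"
    using strict_mono_on_leD[OF assms(3)] assms(4) by auto
  then show "{xs (u - 1)..xs u} \<subseteq> {0..1}" using assms(1,2) by auto
qed

text \<open>Convexity of the array enters here: the indices with \<open>J v = 1\<close> are consecutive, so the sum
  over them telescopes.\<close>

lemma moebius_on_grid_interval:
  assumes r: "r \<noteq> 0" and ab: "a < b" "{a..b} \<subseteq> {0..1}"
    and f: "continuous_map (top_of_set {0..1}) rp1_topology f"
    and h: "continuous_map (top_of_set {0..1}) rp1_topology h"
    and finf: "finite {x \<in> {0..1}. f x = None}" and finh: "finite {y \<in> {0..1}. h y = None}"
    and C1f: "C1_rp1_on f {a..b}"
    and t: "t 0 = 0" "t l = 1" "strict_mono_on {0..l} t"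
    and C1h: "\<forall>v\<in>{1..l}. C1_rp1_on h {t (v - 1)..t v}"
    and J: "\<forall>v\<in>{1..l}. J v \<in> {0, 1::nat}"
    and pq: "p \<le> (q::nat)" "{v \<in> {1..l}. J v = 1} = {p..q}"
    and ne: "\<And>v x y. v \<in> {1..l} \<Longrightarrow> J v = 1 \<Longrightarrow> x \<in> {a..b} \<Longrightarrow> y \<in> {t (v - 1)..t v} \<Longrightarrow> f x \<noteq> h y"
    and K: "\<And>x y. x \<in> {0..1} \<Longrightarrow> y \<in> {0..1} \<Longrightarrow> f x \<noteq> None \<Longrightarrow> h y \<noteq> None \<Longrightarrow>
              K x y = g_formula r f h x y"
    and sum: "\<And>x. x \<in> {a<..<b} \<Longrightarrow> (\<Sum>v=1..l. real (J v) * integral {t (v - 1)..t v} (K x)) = 1"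
  shows "\<exists>M. is_moebius M \<and> (\<forall>x\<in>{a..b}. f x = M (Some (exp (r * x))))"
proof -
  have mem: "v \<in> {1..l} \<and> J v = 1" if "v \<in> {p..q}" for v
    using that pq(2) by blast
  have p: "Suc (p - 1) = p" using mem[of p] pq(1) by auto
  show ?thesis
  proof (rule moebius_of_telescoping_segment[where m = "p - 1" and n = q and t = t and K = K,
        OF r ab f h finf finh C1f, unfolded p])
    show "p - 1 < q" using p pq(1) by linarith
    show "(\<Sum>v=p..q. integral {t (v - 1)..t v} (K x)) = 1" if "x \<in> {a<..<b}" for x
      using sum[OF that] unfolding sum_segment[OF J pq(2)] .
  qed (use mem grid_cell[OF t] C1h ne K in blast)+
qed

theorem corollary4p11:
  fixes r :: real and k l :: nat and I :: "nat \<Rightarrow> nat \<Rightarrow> nat"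
    and xs ys :: "nat \<Rightarrow> real" and \<phi> \<psi> :: "real \<Rightarrow> rp1"
  assumes "r \<noteq> 0"
    and "convex_array k l I"
    and "xs 0 = 0" "xs k = 1" "strict_mono_on {0..k} xs"
    and "ys 0 = 0" "ys l = 1" "strict_mono_on {0..l} ys"
    and "continuous_map (top_of_set {0..1}) rp1_topology \<phi>"
    and "continuous_map (top_of_set {0..1}) rp1_topology \<psi>"
    and "finite {x \<in> {0..1}. \<phi> x = None}"
    and "finite {y \<in> {0..1}. \<psi> y = None}"
    and "\<forall>u\<in>{1..k}. C1_rp1_on \<phi> {xs (u - 1)..xs u}"
    and "\<forall>v\<in>{1..l}. C1_rp1_on \<psi> {ys (v - 1)..ys v}"
    and "\<forall>u\<in>{1..k}. \<forall>v\<in>{1..l}. I u v = 1 \<longrightarrow>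
           (\<forall>x\<in>{xs (u - 1)..xs u}. \<forall>y\<in>{ys (v - 1)..ys v}. \<phi> x \<noteq> \<psi> y)"
    and "\<forall>u\<in>{1..k}. \<forall>v\<in>{1..l}. I u v = 1 \<longrightarrow>
           (\<forall>x\<in>{xs (u - 1)<..<xs u}. \<forall>y\<in>{ys (v - 1)<..<ys v}. g_fun r \<phi> \<psi> x y \<ge> 0)"
    and "\<forall>u\<in>{1..k}. \<forall>x\<in>{xs (u - 1)<..<xs u}.
           (\<Sum>v=1..l. real (I u v) * integral {ys (v - 1)..ys v} (\<lambda>y. g_fun r \<phi> \<psi> x y)) = 1"
    and "\<forall>v\<in>{1..l}. \<forall>y\<in>{ys (v - 1)<..<ys v}.
           (\<Sum>u=1..k. real (I u v) * integral {xs (u - 1)..xs u} (\<lambda>x. g_fun r \<phi> \<psi> x y)) = 1"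
  shows "(\<forall>u\<in>{1..k}. \<exists>m. is_moebius m \<and>
            (\<forall>x\<in>{xs (u - 1)..xs u}. \<phi> x = m (Some (exp (r * x))))) \<and>
         (\<forall>v\<in>{1..l}. \<exists>m. is_moebius m \<and>
            (\<forall>y\<in>{ys (v - 1)..ys v}. \<psi> y = m (Some (exp (r * y))))) \<and>
         (\<forall>u\<in>{1..k}. \<forall>v\<in>{1..l}. I u v = 1 \<longrightarrow>
            (\<exists>a b c d :: real. \<forall>x\<in>{xs (u - 1)<..<xs u}. \<forall>y\<in>{ys (v - 1)<..<ys v}.
               a + b * exp (r * y) + c * exp (r * x) + d * exp (r * (x + y)) \<noteq> 0 \<and>
               g_fun r \<phi> \<psi> x y =
                 - ((a * d - b * c) * r * exp (r * (x + y)) /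
                    (a + b * exp (r * y) + c * exp (r * x) + d * exp (r * (x + y)))\<^sup>2)))"
proof -
  note r = assms(1) and conv = assms(2) and gx = assms(3-5) and gy = assms(6-8)
    and cont = assms(9,10) and fin = assms(11,12) and C1 = assms(13,14) and ne = assms(15)
    and sums = assms(17,18)
  have K: "g_fun r \<phi> \<psi> x y = g_formula r \<phi> \<psi> x y"
    if "x \<in> {0..1}" "y \<in> {0..1}" "\<phi> x \<noteq> None" "\<psi> y \<noteq> None" for x y
    using that by (simp add: g_fun_def finite_part_def)
  have sym: "g_formula r \<phi> \<psi> x y = g_formula r \<psi> \<phi> y x" for x y
    by (simp add: g_formula_def power2_commute mult.commute)
  have mx: "\<exists>m. is_moebius m \<and> (\<forall>x\<in>{xs (u - 1)..xs u}. \<phi> x = m (Some (exp (r * x))))"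
    if u: "u \<in> {1..k}" for u
  proof -
    obtain p q where "p \<le> q" "{v \<in> {1..l}. I u v = 1} = {p..q}"
      using conv u unfolding convex_array_def by blast
    then show ?thesis
    proof (rule moebius_on_grid_interval[where K = "g_fun r \<phi> \<psi>" and J = "I u",
          OF r grid_cell[OF gx u] cont fin bspec[OF C1(1) u] gy C1(2), rotated 1])
      show "\<forall>v\<in>{1..l}. I u v \<in> {0, 1}" using conv u unfolding convex_array_def by blast
    qed (use ne sums(1) u K in blast)+
  qed
  have my: "\<exists>m. is_moebius m \<and> (\<forall>y\<in>{ys (v - 1)..ys v}. \<psi> y = m (Some (exp (r * y))))"
    if v: "v \<in> {1..l}" for v
  proof -
    obtain p q where "p \<le> q" "{u \<in> {1..k}. I u v = 1} = {p..q}"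
      using conv v unfolding convex_array_def by blast
    then show ?thesis
    proof (rule moebius_on_grid_interval[where K = "\<lambda>y x. g_fun r \<phi> \<psi> x y" and J = "\<lambda>u. I u v",
          OF r grid_cell[OF gy v] cont(2,1) fin(2,1) bspec[OF C1(2) v] gx C1(1), rotated 1])
      show "\<forall>u\<in>{1..k}. I u v \<in> {0, 1}" using conv v unfolding convex_array_def by blast
      show "\<psi> y \<noteq> \<phi> x"
        if "u \<in> {1..k}" "I u v = 1" "y \<in> {ys (v - 1)..ys v}" "x \<in> {xs (u - 1)..xs u}" for u x y
        using ne v that by metis
      show "g_fun r \<phi> \<psi> x y = g_formula r \<psi> \<phi> y x"
        if "y \<in> {0..1}" "x \<in> {0..1}" "\<psi> y \<noteq> None" "\<phi> x \<noteq> None" for x y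
        using K that sym by simp
    qed (use sums(2) v in blast)+
  qed
  have "\<exists>a b c d :: real. \<forall>x\<in>{xs (u - 1)<..<xs u}. \<forall>y\<in>{ys (v - 1)<..<ys v}.
      a + b * exp (r * y) + c * exp (r * x) + d * exp (r * (x + y)) \<noteq> 0 \<and>
      g_fun r \<phi> \<psi> x y = - ((a * d - b * c) * r * exp (r * (x + y)) /
        (a + b * exp (r * y) + c * exp (r * x) + d * exp (r * (x + y)))\<^sup>2)"
    if u: "u \<in> {1..k}" and v: "v \<in> {1..l}" and uv: "I u v = 1" for u v
  proof -
    obtain \<alpha> \<beta> \<gamma> \<delta> where m: "\<alpha> * \<delta> - \<beta> * \<gamma> \<noteq> 0"
        "\<forall>x\<in>{xs (u - 1)..xs u}. \<phi> x = moebius_rp1 \<alpha> \<beta> \<gamma> \<delta> (Some (exp (r * x)))"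
      using mx[OF u] unfolding is_moebius_def by blast
    obtain \<alpha>' \<beta>' \<gamma>' \<delta>' where m': "\<alpha>' * \<delta>' - \<beta>' * \<gamma>' \<noteq> 0"
        "\<forall>y\<in>{ys (v - 1)..ys v}. \<psi> y = moebius_rp1 \<alpha>' \<beta>' \<gamma>' \<delta>' (Some (exp (r * y)))"
      using my[OF v] unfolding is_moebius_def by blast
    show ?thesis
    proof (rule kernel_of_moebius[OF r _ _ fin _ _ m(1) m'(1)])
      show "{xs (u - 1)<..<xs u} \<subseteq> {0..1}" "{ys (v - 1)<..<ys v} \<subseteq> {0..1}"
        using grid_cell(2)[OF gx u] grid_cell(2)[OF gy v] greaterThanLessThan_subseteq_atLeastAtMost_iff
        by auto
      show "\<phi> x \<noteq> \<psi> y" if "x \<in> {xs (u - 1)<..<xs u}" "y \<in> {ys (v - 1)<..<ys v}" for x y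
        using ne u v uv that by auto
    qed (use m(2) m'(2) in auto)
  qed
  with mx my show ?thesis by blast
qed

end
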